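(* Let $\alpha,\beta\in\mathbb{R}$ and $\delta,\varepsilon>0$ satisfy $\alpha\neq\beta$ and $(\alpha-\beta)\delta+\varepsilon^2-\delta^2\neq0$, and let $e^{(1)},\dots,e^{(12)}$ be the twelve transformation strains of monoclinic-I martensite with lattice parameters $\alpha,\beta,\delta,\varepsilon$. Then there are precisely eight three-element subsets of $\{e^{(1)},\dots,e^{(12)}\}$ consisting of pairwise incompatible strains, namely $\{e^{(i)},e^{(j)},e^{(k)}\}$ with $$\{i,j,k\}\in\big\{\{1,6,12\},\{1,8,10\},\{2,5,11\},\{2,7,9\},\{3,6,9\},\{3,8,11\},\{4,5,10\},\{4,7,12\}\big\},$$ and each of these eight three-element sets forms a $T_3$.
   Context: Write $M(a,b,c;p,q,s)$ for the real symmetric $3\times 3$ matrix with diagonal entries $a,b,c$, $(1,2)$-entry $p$, $(1,3)$-entry $q$ and $(2,3)$-entry $s$. The twelve transformation strains of monoclinic-I martensite with lattice parameters $\alpha,\beta,\delta,\varepsilon$ are $e^{(1)}=M(\alpha,\alpha,\beta;\delta,\varepsilon,\varepsilon)$, $e^{(2)}=M(\alpha,\alpha,\beta;\delta,-\varepsilon,-\varepsilon)$, $e^{(3)}=M(\alpha,\alpha,\beta;-\delta,-\varepsilon,\varepsilon)$, $e^{(4)}=M(\alpha,\alpha,\beta;-\delta,\varepsilon,-\varepsilon)$, $e^{(5)}=M(\alpha,\beta,\alpha;\varepsilon,\delta,\varepsilon)$, $e^{(6)}=M(\alpha,\beta,\alpha;-\varepsilon,\delta,-\varepsilon)$, $e^{(7)}=M(\alpha,\beta,\alpha;-\varepsilon,-\delta,\varepsilon)$,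 $e^{(8)}=M(\alpha,\beta,\alpha;\varepsilon,-\delta,-\varepsilon)$, $e^{(9)}=M(\beta,\alpha,\alpha;\varepsilon,\varepsilon,\delta)$, $e^{(10)}=M(\beta,\alpha,\alpha;-\varepsilon,-\varepsilon,\delta)$, $e^{(11)}=M(\beta,\alpha,\alpha;-\varepsilon,\varepsilon,-\delta)$, $e^{(12)}=M(\beta,\alpha,\alpha;\varepsilon,-\varepsilon,-\delta)$. Two real symmetric $3\times3$ matrices $e,f$ are compatible if there exist $a,b\in\mathbb{R}^3$ with $e-f=\frac12(a\otimes b+b\otimes a)$; otherwise they are incompatible. With $(e,f)=\{\lambda e+(1-\lambda)f:\lambda\in(0,1)\}$, three real symmetric $3\times3$ matrices $e_1,e_2,e_3$ with equal trace form a $T_3$ if (1) they are pairwise incompatible, and (2) there exist $e_{1,1}\in(e_2,e_3)$, $e_{2,2}\in(e_3,e_1)$, $e_{3,3}\in(e_1,e_2)$ such that $e_{i,i}$ is compatible with $e_i$ for $i=1,2,3$. *)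

theory Defs
  imports "HOL-Analysis.Analysis"
begin

definition sym_mat3 :: "real \<Rightarrow> real \<Rightarrow> real \<Rightarrow> real \<Rightarrow> real \<Rightarrow> real \<Rightarrow> real^3^3" where
  "sym_mat3 a b c p q s =
     vector [vector [a, p, q],
             vector [p, b, s],
             vector [q, s, c]]"

definition monoclinic_I_strains :: "real \<Rightarrow> real \<Rightarrow> real \<Rightarrow> real \<Rightarrow> (real^3^3) list" where
  "monoclinic_I_strains \<alpha> \<beta> \<delta> \<epsilon> =
    [sym_mat3 \<alpha> \<alpha> \<beta> \<delta> \<epsilon> \<epsilon>,
     sym_mat3 \<alpha> \<alpha> \<beta> \<delta> (-\<epsilon>) (-\<epsilon>),
     sym_mat3 \<alpha> \<alpha> \<beta> (-\<delta>) (-\<epsilon>) \<epsilon>,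
     sym_mat3 \<alpha> \<alpha> \<beta> (-\<delta>) \<epsilon> (-\<epsilon>),
     sym_mat3 \<alpha> \<beta> \<alpha> \<epsilon> \<delta> \<epsilon>,
     sym_mat3 \<alpha> \<beta> \<alpha> (-\<epsilon>) \<delta> (-\<epsilon>),
     sym_mat3 \<alpha> \<beta> \<alpha> (-\<epsilon>) (-\<delta>) \<epsilon>,
     sym_mat3 \<alpha> \<beta> \<alpha> \<epsilon> (-\<delta>) (-\<epsilon>),
     sym_mat3 \<beta> \<alpha> \<alpha> \<epsilon> \<epsilon> \<delta>,
     sym_mat3 \<beta> \<alpha> \<alpha> (-\<epsilon>) (-\<epsilon>) \<delta>,
     sym_mat3 \<beta> \<alpha> \<alpha> (-\<epsilon>) \<epsilon> (-\<delta>),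
     sym_mat3 \<beta> \<alpha> \<alpha> \<epsilon> (-\<epsilon>) (-\<delta>)]"

(* The strains are numbered from 1 to 12. *)
definition monoclinic_I_strain :: "real \<Rightarrow> real \<Rightarrow> real \<Rightarrow> real \<Rightarrow> nat \<Rightarrow> real^3^3" where
  "monoclinic_I_strain \<alpha> \<beta> \<delta> \<epsilon> i = monoclinic_I_strains \<alpha> \<beta> \<delta> \<epsilon> ! (i - 1)"

definition tensor_prod :: "real^3 \<Rightarrow> real^3 \<Rightarrow> real^3^3" where
  "tensor_prod a b = (\<chi> i j. a $ i * b $ j)"

definition compatible :: "real^3^3 \<Rightarrow> real^3^3 \<Rightarrow> bool" where
  "compatible e f \<longleftrightarrow>
     (\<exists>a b. e - f = (1/2) *\<^sub>R (tensor_prod a b + tensor_prod b a))"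

abbreviation incompatible :: "real^3^3 \<Rightarrow> real^3^3 \<Rightarrow> bool" where
  "incompatible e f \<equiv> \<not> compatible e f"

(* Differs from the library's open_segment, which is empty when e = f. *)
definition strain_segment :: "real^3^3 \<Rightarrow> real^3^3 \<Rightarrow> (real^3^3) set" where
  "strain_segment e f = {l *\<^sub>R e + (1 - l) *\<^sub>R f | l. l \<in> {0<..<1}}"

definition forms_T3 :: "real^3^3 \<Rightarrow> real^3^3 \<Rightarrow> real^3^3 \<Rightarrow> bool" where
  "forms_T3 e\<^sub>1 e\<^sub>2 e\<^sub>3 \<longleftrightarrow>
     transpose e\<^sub>1 = e\<^sub>1 \<and> transpose e\<^sub>2 = e\<^sub>2 \<and> transpose e\<^sub>3 = e\<^sub>3 \<and>
     trace e\<^sub>1 = trace e\<^sub>2 \<and> trace e\<^sub>2 = trace e\<^sub>3 \<and>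
     incompatible e\<^sub>1 e\<^sub>2 \<and> incompatible e\<^sub>2 e\<^sub>3 \<and> incompatible e\<^sub>3 e\<^sub>1 \<and>
     (\<exists>e\<^sub>1\<^sub>1 \<in> strain_segment e\<^sub>2 e\<^sub>3. \<exists>e\<^sub>2\<^sub>2 \<in> strain_segment e\<^sub>3 e\<^sub>1. \<exists>e\<^sub>3\<^sub>3 \<in> strain_segment e\<^sub>1 e\<^sub>2.
        compatible e\<^sub>1\<^sub>1 e\<^sub>1 \<and> compatible e\<^sub>2\<^sub>2 e\<^sub>2 \<and> compatible e\<^sub>3\<^sub>3 e\<^sub>3)"

definition T3_index_sets :: "nat set set" where
  "T3_index_sets =
     {{1, 6, 12}, {1, 8, 10}, {2, 5, 11}, {2, 7, 9},
      {3, 6, 9}, {3, 8, 11}, {4, 5, 10}, {4, 7, 12}}"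

end

theory Submission
  imports Defs
begin

text \<open>
  All twelve strains have the same trace, so every difference that matters is a symmetric matrix
  with trace zero.  For such a matrix, being a symmetrised tensor product is equivalent to having
  determinant zero (lemma \<open>compatible_iff_det\<close>): a singular one has eigenvalues
  \<open>-\<mu>, 0, \<mu>\<close>, and its quadratic form \<open>\<mu> (x\<^sup>2 - y\<^sup>2)\<close> factors into two linear forms.

  The determinants of the pairwise differences all lie in \<open>{-K, 0, K}\<close> with
  \<open>K = 4\<epsilon>((\<alpha> - \<beta>)\<delta> + \<epsilon>\<^sup>2 - \<delta>\<^sup>2)\<close>, which is not zero by assumption
  (lemma \<open>det_strain_diff\<close>).  As \<open>det (-A) = - det A\<close> in dimension three, the signs orient the
  graph of incompatible pairs.  This graph is the cuboctahedron: the twelve strains correspond to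
  the edges of a cube, and two of them are incompatible when these edges share a corner.  Hence
  its triangles are the eight corners of the cube (lemma \<open>triangles\<close>).

  What makes every triangle a \<open>T\<^sub>3\<close> is that the orientation goes round it: for a suitable order
  of its vertices, \<open>det (e\<^sub>1 - e\<^sub>2)\<close>, \<open>det (e\<^sub>2 - e\<^sub>3)\<close> and \<open>det (e\<^sub>3 - e\<^sub>1)\<close> have one and the
  same sign.  Hence \<open>x \<mapsto> det (x - e\<^sub>1)\<close> takes opposite signs at the ends of the segment from
  \<open>e\<^sub>2\<close> to \<open>e\<^sub>3\<close>, and by the intermediate value theorem some interior point of that segment is
  compatible with \<open>e\<^sub>1\<close>; likewise for the two other vertices (lemma \<open>forms_T3_if_cyclic_det\<close>).
\<close>

section \<open>Compatibility of strains with equal trace\<close>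

lemma matrix_eq_3: "(A::real^3^3) = B \<longleftrightarrow> (\<forall>i j. A $ i $ j = B $ i $ j)"
  by (simp add: vec_eq_iff)

lemma sym_mat3_nth [simp]:
  "sym_mat3 a b c p q s $ 1 $ 1 = a" "sym_mat3 a b c p q s $ 1 $ 2 = p"
  "sym_mat3 a b c p q s $ 1 $ 3 = q" "sym_mat3 a b c p q s $ 2 $ 1 = p"
  "sym_mat3 a b c p q s $ 2 $ 2 = b" "sym_mat3 a b c p q s $ 2 $ 3 = s"
  "sym_mat3 a b c p q s $ 3 $ 1 = q" "sym_mat3 a b c p q s $ 3 $ 2 = s"
  "sym_mat3 a b c p q s $ 3 $ 3 = c"
  by (simp_all add: sym_mat3_def)

lemma sym_mat3_eq_iff:
  "sym_mat3 a b c p q s = sym_mat3 a' b' c' p' q' s' \<longleftrightarrow>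
     a = a' \<and> b = b' \<and> c = c' \<and> p = p' \<and> q = q' \<and> s = s'"
  by (auto simp: matrix_eq_3 forall_3)

lemma sym_mat3_diff:
  "sym_mat3 a b c p q s - sym_mat3 a' b' c' p' q' s' =
     sym_mat3 (a - a') (b - b') (c - c') (p - p') (q - q') (s - s')"
  by (simp add: matrix_eq_3 forall_3)

lemma det_sym_mat3:
  "det (sym_mat3 a b c p q s) = a * b * c + 2 * p * q * s - a * s\<^sup>2 - b * q\<^sup>2 - c * p\<^sup>2"
  by (simp add: det_3 power2_eq_square algebra_simps)

lemma det_zero_3: "det (0 :: real^3^3) = 0"
  by (simp add: det_3)

lemma symmetric_eq_sym_mat3:
  fixes A :: "real^3^3"
  assumes "transpose A = A"
  shows "A = sym_mat3 (A$1$1) (A$2$2) (A$3$3) (A$1$2) (A$1$3) (A$2$3)"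
proof -
  have "A $ j $ i = A $ i $ j" for i j
    using arg_cong[OF assms, of "\<lambda>M. M $ i $ j"] by (simp add: transpose_def)
  from this[of 1 2] this[of 1 3] this[of 2 3] show ?thesis
    by (simp add: matrix_eq_3 forall_3)
qed

lemma rank_one_eq_tensor_prod:
  fixes B :: "real^3^3"
  assumes "\<And>i j k l. B $ i $ j * B $ k $ l = B $ i $ l * B $ k $ j"
  shows "\<exists>u v. B = tensor_prod u v"
proof (cases "B = 0")
  case True
  then have "B = tensor_prod 0 0" by (simp add: matrix_eq_3 tensor_prod_def)
  then show ?thesis by blast
next
  case False
  then obtain i j where nz: "B $ i $ j \<noteq> 0" by (auto simp: matrix_eq_3)
  have "B = tensor_prod (\<chi> k. B $ k $ j / B $ i $ j) (B $ i)"
    using nz assms[of i j] by (simp add: matrix_eq_3 tensor_prod_def field_simps)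
  then show ?thesis by blast
qed

text \<open>
  The matrix with diagonal \<open>x\<^sub>1, x\<^sub>2, x\<^sub>3\<close> and off-diagonal entries \<open>y\<close> has rank at most one and
  non-negative trace, hence it is positive semidefinite and equals \<open>w \<otimes> w\<close> for some \<open>w\<close>: a row with
  positive diagonal entry, divided by the square root of that entry, will do.
\<close>

lemma rank_one_square_root:
  fixes x\<^sub>1 x\<^sub>2 x\<^sub>3 y\<^sub>1\<^sub>2 y\<^sub>1\<^sub>3 y\<^sub>2\<^sub>3 :: real
  assumes "0 \<le> x\<^sub>1 + x\<^sub>2 + x\<^sub>3"
    and "x\<^sub>1 * x\<^sub>2 = y\<^sub>1\<^sub>2\<^sup>2" "x\<^sub>1 * x\<^sub>3 = y\<^sub>1\<^sub>3\<^sup>2" "x\<^sub>2 * x\<^sub>3 = y\<^sub>2\<^sub>3\<^sup>2"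
    and "x\<^sub>1 * y\<^sub>2\<^sub>3 = y\<^sub>1\<^sub>2 * y\<^sub>1\<^sub>3" "x\<^sub>2 * y\<^sub>1\<^sub>3 = y\<^sub>1\<^sub>2 * y\<^sub>2\<^sub>3" "x\<^sub>3 * y\<^sub>1\<^sub>2 = y\<^sub>1\<^sub>3 * y\<^sub>2\<^sub>3"
  obtains w\<^sub>1 w\<^sub>2 w\<^sub>3 where "w\<^sub>1\<^sup>2 = x\<^sub>1" "w\<^sub>2\<^sup>2 = x\<^sub>2" "w\<^sub>3\<^sup>2 = x\<^sub>3"
    "w\<^sub>1 * w\<^sub>2 = y\<^sub>1\<^sub>2" "w\<^sub>1 * w\<^sub>3 = y\<^sub>1\<^sub>3" "w\<^sub>2 * w\<^sub>3 = y\<^sub>2\<^sub>3"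
proof -
  have root: "\<exists>w\<^sub>1 w\<^sub>2 w\<^sub>3. w\<^sub>1\<^sup>2 = a \<and> w\<^sub>2\<^sup>2 = b \<and> w\<^sub>3\<^sup>2 = c \<and>
                 w\<^sub>1 * w\<^sub>2 = p \<and> w\<^sub>1 * w\<^sub>3 = q \<and> w\<^sub>2 * w\<^sub>3 = s"
    if "0 < a" "a * b = p\<^sup>2" "a * c = q\<^sup>2" "a * s = p * q" for a b c p q s :: real
    using that
    by (intro exI[of _ "sqrt a"] exI[of _ "p / sqrt a"] exI[of _ "q / sqrt a"])
       (simp add: power_divide field_simps)
  consider "0 < x\<^sub>1" | "0 < x\<^sub>2" | "0 < x\<^sub>3" | "x\<^sub>1 \<le> 0" "x\<^sub>2 \<le> 0" "x\<^sub>3 \<le> 0"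
    by linarith
  then show ?thesis
  proof cases
    case 1
    from root[of x\<^sub>1 x\<^sub>2 y\<^sub>1\<^sub>2 x\<^sub>3 y\<^sub>1\<^sub>3 y\<^sub>2\<^sub>3] 1 assms show ?thesis
      using that by blast
  next
    case 2
    from root[of x\<^sub>2 x\<^sub>1 y\<^sub>1\<^sub>2 x\<^sub>3 y\<^sub>2\<^sub>3 y\<^sub>1\<^sub>3] 2 assms show ?thesis
      using that by (auto simp: mult.commute)
  next
    case 3
    from root[of x\<^sub>3 x\<^sub>1 y\<^sub>1\<^sub>3 x\<^sub>2 y\<^sub>2\<^sub>3 y\<^sub>1\<^sub>2] 3 assms show ?thesis
      using that by (auto simp: mult.commute)
  next
    case 4
    with assms(1) have "x\<^sub>1 = 0" "x\<^sub>2 = 0" "x\<^sub>3 = 0" by linarith+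
    with assms that[of 0 0 0] show ?thesis by simp
  qed
qed

text \<open>
  The quadratic form of a singular matrix \<open>E\<close> with trace zero is a degenerate conic, and the proof
  splits it into two lines in the classical way.  The adjugate of \<open>E\<close> has rank at most one, and its
  trace is \<open>- |E|\<^sup>2 / 2\<close> since \<open>tr E = 0\<close>; so it equals \<open>- w \<otimes> w\<close> for some \<open>w\<close>, and \<open>E w = 0\<close>.
  Adding the skew matrix of \<open>w\<close> to \<open>E\<close> makes all two-by-two minors vanish without changing the
  symmetric part.
\<close>

lemma traceless_singular_eq_sym_tensor_prod:
  fixes a b c p q s :: real
  assumes tr: "a + b + c = 0" and det: "det (sym_mat3 a b c p q s) = 0"
  shows "\<exists>u v. sym_mat3 a b c p q s = (1/2) *\<^sub>R (tensor_prod u v + tensor_prod v u)"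
proof -
  have D: "a * b * c + 2 * p * q * s - a * s\<^sup>2 - b * q\<^sup>2 - c * p\<^sup>2 = 0"
    using det by (simp add: det_sym_mat3)
  have "2 * ((s\<^sup>2 - b * c) + (q\<^sup>2 - a * c) + (p\<^sup>2 - a * b)) =
          2 * s\<^sup>2 + 2 * q\<^sup>2 + 2 * p\<^sup>2 + a\<^sup>2 + b\<^sup>2 + c\<^sup>2 - (a + b + c)\<^sup>2"
    by (simp add: power2_eq_square algebra_simps)
  also have "\<dots> \<ge> 0" by (simp add: tr)
  finally have nonneg: "0 \<le> (s\<^sup>2 - b * c) + (q\<^sup>2 - a * c) + (p\<^sup>2 - a * b)" by simp
  obtain w\<^sub>1 w\<^sub>2 w\<^sub>3 where w:
    "w\<^sub>1\<^sup>2 = s\<^sup>2 - b * c" "w\<^sub>2\<^sup>2 = q\<^sup>2 - a * c" "w\<^sub>3\<^sup>2 = p\<^sup>2 - a * b"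
    "w\<^sub>1 * w\<^sub>2 = p * c - q * s" "w\<^sub>1 * w\<^sub>3 = q * b - p * s" "w\<^sub>2 * w\<^sub>3 = a * s - p * q"
  proof (rule rank_one_square_root[OF nonneg])
    show "(s\<^sup>2 - b * c) * (q\<^sup>2 - a * c) = (p * c - q * s)\<^sup>2" using D by algebra
    show "(s\<^sup>2 - b * c) * (p\<^sup>2 - a * b) = (q * b - p * s)\<^sup>2" using D by algebra
    show "(q\<^sup>2 - a * c) * (p\<^sup>2 - a * b) = (a * s - p * q)\<^sup>2" using D by algebra
    show "(s\<^sup>2 - b * c) * (a * s - p * q) = (p * c - q * s) * (q * b - p * s)" using D by algebra
    show "(q\<^sup>2 - a * c) * (q * b - p * s) = (p * c - q * s) * (a * s - p * q)" using D by algebra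
    show "(p\<^sup>2 - a * b) * (p * c - q * s) = (q * b - p * s) * (a * s - p * q)" using D by algebra
  qed
  \<comment> \<open>The products of \<open>E w\<close> with the entries of \<open>w\<close> are entries of \<open>- E (adj E) = 0\<close>.\<close>
  have kernel: "a * w\<^sub>1 + p * w\<^sub>2 + q * w\<^sub>3 = 0" "p * w\<^sub>1 + b * w\<^sub>2 + s * w\<^sub>3 = 0" "q * w\<^sub>1 + s * w\<^sub>2 + c * w\<^sub>3 = 0"
  proof -
    have "(a * w\<^sub>1 + p * w\<^sub>2 + q * w\<^sub>3)\<^sup>2 = 0" using w D by algebra
    then show "a * w\<^sub>1 + p * w\<^sub>2 + q * w\<^sub>3 = 0" by simp
    have "(p * w\<^sub>1 + b * w\<^sub>2 + s * w\<^sub>3)\<^sup>2 = 0" using w D by algebra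
    then show "p * w\<^sub>1 + b * w\<^sub>2 + s * w\<^sub>3 = 0" by simp
    have "(q * w\<^sub>1 + s * w\<^sub>2 + c * w\<^sub>3)\<^sup>2 = 0" using w D by algebra
    then show "q * w\<^sub>1 + s * w\<^sub>2 + c * w\<^sub>3 = 0" by simp
  qed
  define B :: "real^3^3" where
    "B = vector [vector [a, p - w\<^sub>3, q + w\<^sub>2], vector [p + w\<^sub>3, b, s - w\<^sub>1], vector [q - w\<^sub>2, s + w\<^sub>1, c]]"
  have minors:
    "a * b = (p - w\<^sub>3) * (p + w\<^sub>3)"
    "a * c = (q + w\<^sub>2) * (q - w\<^sub>2)"
    "b * c = (s - w\<^sub>1) * (s + w\<^sub>1)"
    "a * (s - w\<^sub>1) = (q + w\<^sub>2) * (p + w\<^sub>3)"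
    "a * (s + w\<^sub>1) = (p - w\<^sub>3) * (q - w\<^sub>2)"
    "b * (q + w\<^sub>2) = (p - w\<^sub>3) * (s - w\<^sub>1)"
    "b * (q - w\<^sub>2) = (p + w\<^sub>3) * (s + w\<^sub>1)"
    "c * (p - w\<^sub>3) = (q + w\<^sub>2) * (s + w\<^sub>1)"
    "c * (p + w\<^sub>3) = (q - w\<^sub>2) * (s - w\<^sub>1)"
    using w kernel by algebra+
  have "B $ i $ j * B $ k $ l = B $ i $ l * B $ k $ j" for i j k l
  proof -
    have "\<forall>i j k l. B $ i $ j * B $ k $ l = B $ i $ l * B $ k $ j"
      unfolding forall_3 by (simp add: B_def minors mult.commute)
    then show ?thesis by blast
  qed
  then obtain u v where "B = tensor_prod u v"
    using rank_one_eq_tensor_prod by blast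
  moreover have "sym_mat3 a b c p q s = (1/2) *\<^sub>R (B + transpose B)"
    by (simp add: matrix_eq_3 forall_3 B_def transpose_def)
  moreover have "transpose (tensor_prod u v) = tensor_prod v u"
    by (simp add: matrix_eq_3 tensor_prod_def transpose_def)
  ultimately show ?thesis by auto
qed

lemma det_sym_tensor_prod: "det ((1/2) *\<^sub>R (tensor_prod u v + tensor_prod v u)) = 0"
  by (simp add: det_3 tensor_prod_def algebra_simps)

lemma compatible_iff_det:
  assumes "transpose e = e" "transpose f = f" "trace e = trace f"
  shows "compatible e f \<longleftrightarrow> det (e - f) = 0"
proof
  assume "compatible e f"
  then show "det (e - f) = 0"
    unfolding compatible_def using det_sym_tensor_prod by auto
next
  assume det: "det (e - f) = 0"
  have "transpose (e - f) = e - f"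
    using assms(1,2) by (simp add: transpose_def vec_eq_iff)
  from symmetric_eq_sym_mat3[OF this] obtain a b c p q s
    where E: "e - f = sym_mat3 a b c p q s" by blast
  have "trace (e - f) = 0" using assms(3) by (simp add: trace_sub)
  then have "a + b + c = 0" by (simp add: E trace_def sum_3)
  with det show "compatible e f"
    unfolding compatible_def E by (intro traceless_singular_eq_sym_tensor_prod)
qed

section \<open>Three strains whose differences have determinants of one sign\<close>

lemma det_diff_commute: "det (A - B) = - det (B - A)" for A B :: "real^3^3"
  by (simp add: det_3 algebra_simps)

text \<open>
  The determinant is a continuous function on the segment; strictly opposite signs at its ends
  also keep the zero away from the ends, as an open segment requires.
\<close>

lemma segment_compatible:
  fixes e f g :: "real^3^3"
  assumes sym: "transpose e = e" "transpose f = f" "transpose g = g"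
    and tr: "trace e = trace f" "trace f = trace g"
    and sgn: "det (e - f) * det (g - e) > 0"
  shows "\<exists>x \<in> strain_segment f g. compatible x e"
proof -
  define x where "x t = t *\<^sub>R f + (1 - t) *\<^sub>R g" for t :: real
  have x01: "x 0 = g" "x 1 = f" by (simp_all add: x_def)
  have cont: "continuous_on {0..1} (\<lambda>t. det (x t - e))"
    unfolding det_3 x_def by (simp, intro continuous_intros)
  have opp: "det (x 0 - e) * det (x 1 - e) < 0"
    using sgn by (simp add: x01 det_diff_commute[of f e] mult.commute)
  have "\<exists>t\<ge>0. t \<le> 1 \<and> det (x t - e) = 0"
  proof (cases "det (x 0 - e) < 0")
    case True
    with opp show ?thesis
      by (intro IVT') (auto simp: cont mult_less_0_iff)
  next
    case False
    with opp show ?thesis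
      by (intro IVT2') (auto simp: cont mult_less_0_iff)
  qed
  then obtain t where t: "0 \<le> t" "t \<le> 1" "det (x t - e) = 0" by blast
  with opp have "t \<noteq> 0" "t \<noteq> 1" by auto
  with t have "x t \<in> strain_segment f g"
    by (auto simp: strain_segment_def x_def)
  moreover have "transpose (x t) = x t"
    using sym by (simp add: x_def transpose_def vec_eq_iff)
  moreover have "trace (x t) = trace e"
  proof -
    have "trace (x t) = t * trace f + (1 - t) * trace g"
      by (simp add: x_def trace_def sum_3 algebra_simps)
    also have "\<dots> = trace e" by (simp add: tr algebra_simps)
    finally show ?thesis .
  qed
  ultimately show ?thesis
    using t(3) sym(1) compatible_iff_det[of "x t" e] by blast
qed

lemma forms_T3_if_cyclic_det:
  fixes e f g :: "real^3^3"
  assumes sym: "transpose e = e" "transpose f = f" "transpose g = g"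
    and tr: "trace e = trace f" "trace f = trace g"
    and "d \<noteq> 0" and det: "det (e - f) = d" "det (f - g) = d" "det (g - e) = d"
  shows "forms_T3 e f g"
proof -
  have pos: "d * d > 0" using \<open>d \<noteq> 0\<close> by (auto simp: zero_less_mult_iff)
  have "\<exists>x \<in> strain_segment f g. compatible x e"
    by (rule segment_compatible) (use sym tr in \<open>simp_all only: det pos\<close>)
  moreover have "\<exists>x \<in> strain_segment g e. compatible x f"
    by (rule segment_compatible) (use sym tr in \<open>simp_all only: det pos\<close>)
  moreover have "\<exists>x \<in> strain_segment e f. compatible x g"
    by (rule segment_compatible) (use sym tr in \<open>simp_all only: det pos\<close>)
  moreover have "incompatible e f" "incompatible f g" "incompatible g e"
    using \<open>d \<noteq> 0\<close> det sym tr by (metis compatible_iff_det)+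
  ultimately show ?thesis
    using sym tr unfolding forms_T3_def by blast
qed

section \<open>The oriented graph of incompatible strains\<close>

text \<open>
  The pairs \<open>(i, j)\<close> with \<open>det (e\<^sup>(\<^sup>i\<^sup>) - e\<^sup>(\<^sup>j\<^sup>)) = K\<close>, grouped into the eight oriented
  triangles.  The table follows this rule: every strain arises from the one with positive
  off-diagonal entries and \<open>\<beta>\<close> at the same place of the diagonal by changing the sign of at most
  one coordinate axis.  Two strains are incompatible exactly if their \<open>\<beta>\<close> stand at different
  places \<open>a\<close> and \<open>b\<close> and they differ by the sign of the axis \<open>a\<close> or by that of \<open>b\<close>, up to an
  overall sign.
\<close>

definition arcs :: "(nat \<times> nat) set" where
  "arcs = {(1, 6), (6, 12), (12, 1),   (1, 10), (10, 8), (8, 1),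
           (2, 11), (11, 5), (5, 2),   (2, 7), (7, 9), (9, 2),
           (3, 9), (9, 6), (6, 3),     (3, 8), (8, 11), (11, 3),
           (4, 5), (5, 10), (10, 4),   (4, 12), (12, 7), (7, 4)}"

definition linked :: "nat \<Rightarrow> nat \<Rightarrow> bool" where
  "linked i j \<longleftrightarrow> (i, j) \<in> arcs \<or> (j, i) \<in> arcs"

definition cyclic :: "nat \<Rightarrow> nat \<Rightarrow> nat \<Rightarrow> bool" where
  "cyclic i j k \<longleftrightarrow> (i, j) \<in> arcs \<and> (j, k) \<in> arcs \<and> (k, i) \<in> arcs"

lemma arcs_asym: "(i, j) \<in> arcs \<Longrightarrow> (j, i) \<notin> arcs"
  by (simp add: arcs_def, elim disjE conjE; simp)

lemma arcs_bounds: "(i, j) \<in> arcs \<Longrightarrow> i \<in> {1..12} \<and> j \<in> {1..12}"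
  by (simp add: arcs_def, elim disjE conjE; simp)

lemma cyclic_distinct:
  assumes "cyclic a b c"
  shows "a \<noteq> b" "b \<noteq> c" "c \<noteq> a"
  using assms arcs_asym unfolding cyclic_def by blast+

text \<open>
  The ends of an arc have exactly one common neighbour, and the arcs through it close the directed
  cycle.
\<close>

lemma linked_triangle:
  assumes "linked i j" "linked j k" "linked k i"
  shows "cyclic i j k \<or> cyclic k j i"
proof -
  from assms(1) have "(i, j) \<in> arcs \<or> (j, i) \<in> arcs" by (simp only: linked_def)
  then show ?thesis
    unfolding arcs_def insert_iff empty_iff prod.inject
    by (elim disjE conjE FalseE; use assms(2,3) in \<open>simp add: linked_def cyclic_def arcs_def; elim disjE; simp\<close>)
qed

lemma cyclic_in_T3_index_sets:
  assumes "cyclic a b c"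
  shows "{a, b, c} \<in> T3_index_sets"
proof -
  from assms have arc: "(a, b) \<in> arcs" and rest: "(b, c) \<in> arcs" "(c, a) \<in> arcs"
    by (simp_all only: cyclic_def)
  from arc show ?thesis
    unfolding arcs_def insert_iff empty_iff prod.inject
    by (elim disjE conjE FalseE; use rest in \<open>simp add: arcs_def; elim disjE; simp add: T3_index_sets_def insert_commute\<close>)
qed

lemma T3_index_sets_cyclic:
  assumes "I \<in> T3_index_sets"
  shows "\<exists>a b c. I = {a, b, c} \<and> cyclic a b c"
proof -
  have "cyclic 1 6 12" "cyclic 8 1 10" "cyclic 5 2 11" "cyclic 2 7 9"
       "cyclic 6 3 9" "cyclic 3 8 11" "cyclic 4 5 10" "cyclic 7 4 12"
    by (simp_all add: cyclic_def arcs_def)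
  moreover from assms have "I = {1, 6, 12} \<or> I = {8, 1, 10} \<or> I = {5, 2, 11} \<or> I = {2, 7, 9} \<or>
      I = {6, 3, 9} \<or> I = {3, 8, 11} \<or> I = {4, 5, 10} \<or> I = {7, 4, 12}"
    unfolding T3_index_sets_def insert_iff empty_iff
    by (elim disjE FalseE) (simp_all only: insert_commute simp_thms)
  ultimately show ?thesis by blast
qed

lemma triangles:
  "{I. I \<subseteq> {1..12} \<and> card I = 3 \<and> pairwise linked I} = T3_index_sets"
proof (intro equalityI subsetI)
  fix I assume "I \<in> {I. I \<subseteq> {1..12} \<and> card I = 3 \<and> pairwise linked I}"
  then have "card I = 3" and linked: "pairwise linked I" by auto
  then obtain i j k where I: "I = {i, j, k}" "i \<noteq> j" "j \<noteq> k" "k \<noteq> i"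
    by (auto simp: card_3_iff)
  with linked have "linked i j" "linked j k" "linked k i"
    by (auto simp: pairwise_def)
  then have "cyclic i j k \<or> cyclic k j i" by (rule linked_triangle)
  then show "I \<in> T3_index_sets"
    using cyclic_in_T3_index_sets[of i j k] cyclic_in_T3_index_sets[of k j i]
    by (auto simp: I insert_commute)
next
  fix I assume "I \<in> T3_index_sets"
  then obtain a b c where I: "I = {a, b, c}" and cyc: "cyclic a b c"
    using T3_index_sets_cyclic by blast
  from cyc have "I \<subseteq> {1..12}"
    using arcs_bounds unfolding I cyclic_def by blast
  moreover have "card I = 3"
    using cyclic_distinct[OF cyc] by (simp add: I)
  moreover have "pairwise linked I"
    using cyc by (auto simp: I cyclic_def linked_def pairwise_def)
  ultimately show "I \<in> {I. I \<subseteq> {1..12} \<and> card I = 3 \<and> pairwise linked I}" by blast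
qed

lemma T3_index_triple_cyclic:
  assumes "{i, j, k} \<in> T3_index_sets"
  shows "cyclic i j k \<or> cyclic k j i"
proof -
  from assms have "{i, j, k} \<in> {I. I \<subseteq> {1..12} \<and> card I = 3 \<and> pairwise linked I}"
    by (simp only: triangles)
  then have card: "card {i, j, k} = 3" and linked: "pairwise linked {i, j, k}" by auto
  from card have "i \<noteq> j" "j \<noteq> k" "k \<noteq> i"
    by (auto simp: card_insert_if split: if_splits)
  with linked show ?thesis
    by (intro linked_triangle) (auto simp: pairwise_def)
qed

lemma card_T3_index_sets: "card T3_index_sets = 8"
proof -
  define L :: "nat list list" where
    "L = [[1, 6, 12], [1, 8, 10], [2, 5, 11], [2, 7, 9], [3, 6, 9], [3, 8, 11], [4, 5, 10], [4, 7, 12]]"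
  have "T3_index_sets = set ` set L"
    by (simp add: T3_index_sets_def L_def)
  moreover have "inj_on set (set L)"
    by (rule inj_onI, rule sorted_distinct_set_unique) (auto simp: L_def)
  ultimately have "card T3_index_sets = card (set L)"
    by (metis card_image)
  then show ?thesis by (simp add: L_def)
qed

section \<open>The monoclinic-I strains\<close>

lemma strain_table:
  "monoclinic_I_strain \<alpha> \<beta> \<delta> \<epsilon> 1 = sym_mat3 \<alpha> \<alpha> \<beta> \<delta> \<epsilon> \<epsilon>"
  "monoclinic_I_strain \<alpha> \<beta> \<delta> \<epsilon> 2 = sym_mat3 \<alpha> \<alpha> \<beta> \<delta> (-\<epsilon>) (-\<epsilon>)"
  "monoclinic_I_strain \<alpha> \<beta> \<delta> \<epsilon> 3 = sym_mat3 \<alpha> \<alpha> \<beta> (-\<delta>) (-\<epsilon>) \<epsilon>"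
  "monoclinic_I_strain \<alpha> \<beta> \<delta> \<epsilon> 4 = sym_mat3 \<alpha> \<alpha> \<beta> (-\<delta>) \<epsilon> (-\<epsilon>)"
  "monoclinic_I_strain \<alpha> \<beta> \<delta> \<epsilon> 5 = sym_mat3 \<alpha> \<beta> \<alpha> \<epsilon> \<delta> \<epsilon>"
  "monoclinic_I_strain \<alpha> \<beta> \<delta> \<epsilon> 6 = sym_mat3 \<alpha> \<beta> \<alpha> (-\<epsilon>) \<delta> (-\<epsilon>)"
  "monoclinic_I_strain \<alpha> \<beta> \<delta> \<epsilon> 7 = sym_mat3 \<alpha> \<beta> \<alpha> (-\<epsilon>) (-\<delta>) \<epsilon>"
  "monoclinic_I_strain \<alpha> \<beta> \<delta> \<epsilon> 8 = sym_mat3 \<alpha> \<beta> \<alpha> \<epsilon> (-\<delta>) (-\<epsilon>)"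
  "monoclinic_I_strain \<alpha> \<beta> \<delta> \<epsilon> 9 = sym_mat3 \<beta> \<alpha> \<alpha> \<epsilon> \<epsilon> \<delta>"
  "monoclinic_I_strain \<alpha> \<beta> \<delta> \<epsilon> 10 = sym_mat3 \<beta> \<alpha> \<alpha> (-\<epsilon>) (-\<epsilon>) \<delta>"
  "monoclinic_I_strain \<alpha> \<beta> \<delta> \<epsilon> 11 = sym_mat3 \<beta> \<alpha> \<alpha> (-\<epsilon>) \<epsilon> (-\<delta>)"
  "monoclinic_I_strain \<alpha> \<beta> \<delta> \<epsilon> 12 = sym_mat3 \<beta> \<alpha> \<alpha> \<epsilon> (-\<epsilon>) (-\<delta>)"
  by (simp_all add: monoclinic_I_strain_def monoclinic_I_strains_def)

lemma index_cases:
  assumes "i \<in> {1..12::nat}"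
  shows "i = 1 \<or> i = 2 \<or> i = 3 \<or> i = 4 \<or> i = 5 \<or> i = 6 \<or>
         i = 7 \<or> i = 8 \<or> i = 9 \<or> i = 10 \<or> i = 11 \<or> i = 12"
  using assms unfolding atLeastAtMost_iff by presburger

lemma transpose_strain:
  assumes "i \<in> {1..12}"
  shows "transpose (monoclinic_I_strain \<alpha> \<beta> \<delta> \<epsilon> i) = monoclinic_I_strain \<alpha> \<beta> \<delta> \<epsilon> i"
proof -
  have "transpose (sym_mat3 a b c p q s) = sym_mat3 a b c p q s" for a b c p q s
    by (simp add: matrix_eq_3 forall_3 transpose_def)
  with index_cases[OF assms] show ?thesis
    by (elim disjE) (simp_all add: strain_table[simplified])
qed

lemma trace_strain:
  assumes "i \<in> {1..12}"
  shows "trace (monoclinic_I_strain \<alpha> \<beta> \<delta> \<epsilon> i) = 2 * \<alpha> + \<beta>"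
  using index_cases[OF assms]
  by (elim disjE) (simp_all add: strain_table[simplified] trace_def sum_3)

lemma inj_on_strain:
  assumes "\<delta> > 0" "\<epsilon> > 0" "\<alpha> \<noteq> \<beta>"
  shows "inj_on (monoclinic_I_strain \<alpha> \<beta> \<delta> \<epsilon>) {1..12}"
proof (rule inj_onI)
  fix i j :: nat
  assume i: "i \<in> {1..12}" and j: "j \<in> {1..12}"
    and "monoclinic_I_strain \<alpha> \<beta> \<delta> \<epsilon> i = monoclinic_I_strain \<alpha> \<beta> \<delta> \<epsilon> j"
  then show "i = j"
    using index_cases[OF i] index_cases[OF j] assms
    by (elim disjE) (simp_all add: strain_table[simplified] sym_mat3_eq_iff)
qed

lemma det_strain_diff:
  assumes "i \<in> {1..12}" "j \<in> {1..12}"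
  shows "det (monoclinic_I_strain \<alpha> \<beta> \<delta> \<epsilon> i - monoclinic_I_strain \<alpha> \<beta> \<delta> \<epsilon> j) =
           (of_bool ((i, j) \<in> arcs) - of_bool ((j, i) \<in> arcs)) *
           (4 * \<epsilon> * ((\<alpha> - \<beta>) * \<delta> + \<epsilon>\<^sup>2 - \<delta>\<^sup>2))"
  using index_cases[OF assms(1)] index_cases[OF assms(2)]
  by (elim disjE; hypsubst)
     (simp_all add: strain_table[simplified] sym_mat3_diff det_sym_mat3 det_zero_3 arcs_def,
      simp_all add: power2_eq_square algebra_simps)

theorem mainTheorem2:
  fixes \<alpha> \<beta> \<delta> \<epsilon> :: real
  assumes "\<delta> > 0" and "\<epsilon> > 0"
    and "\<alpha> \<noteq> \<beta>"
    and "(\<alpha> - \<beta>) * \<delta> + \<epsilon>\<^sup>2 - \<delta>\<^sup>2 \<noteq> 0"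
  defines "e \<equiv> monoclinic_I_strain \<alpha> \<beta> \<delta> \<epsilon>"
  shows "{S. S \<subseteq> e ` {1..12} \<and> card S = 3 \<and> pairwise incompatible S}
           = {{e i, e j, e k} | i j k. {i, j, k} \<in> T3_index_sets}
       \<and> card {S. S \<subseteq> e ` {1..12} \<and> card S = 3 \<and> pairwise incompatible S} = 8
       \<and> (\<forall>i j k. {i, j, k} \<in> T3_index_sets \<longrightarrow> forms_T3 (e i) (e j) (e k))"
proof -
  define K where "K = 4 * \<epsilon> * ((\<alpha> - \<beta>) * \<delta> + \<epsilon>\<^sup>2 - \<delta>\<^sup>2)"
  have "K \<noteq> 0" using assms(2,4) by (simp add: K_def)
  have inj: "inj_on e {1..12}"
    using assms(1-3) unfolding e_def by (rule inj_on_strain)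
  have sym: "transpose (e i) = e i" and tr: "trace (e i) = 2 * \<alpha> + \<beta>" if "i \<in> {1..12}" for i
    using that unfolding e_def by (rule transpose_strain, rule trace_strain)
  have det: "det (e i - e j) = (of_bool ((i, j) \<in> arcs) - of_bool ((j, i) \<in> arcs)) * K"
    if "i \<in> {1..12}" "j \<in> {1..12}" for i j
    using that unfolding e_def K_def by (rule det_strain_diff)
  have arc: "det (e i - e j) = K" if "(i, j) \<in> arcs" for i j
    using that arcs_asym[OF that] arcs_bounds[OF that] det[of i j] by simp
  have reverse_arc: "det (e j - e i) = - K" if "(i, j) \<in> arcs" for i j
    using arc[OF that] det_diff_commute[of "e j" "e i"] by simp
  have incompat: "incompatible (e i) (e j) \<longleftrightarrow> linked i j" if "i \<in> {1..12}" "j \<in> {1..12}" for i j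
    using that \<open>K \<noteq> 0\<close> arcs_asym[of i j]
    by (auto simp: compatible_iff_det sym tr det linked_def)
  have pairwise: "pairwise incompatible (e ` I) \<longleftrightarrow> pairwise linked I" if "I \<subseteq> {1..12}" for I
  proof -
    have "pairwise incompatible (e ` I) \<longleftrightarrow> pairwise (\<lambda>i j. incompatible (e i) (e j)) I"
      using inj_on_subset[OF inj that] by (auto simp: pairwise_def inj_on_def)
    also have "\<dots> \<longleftrightarrow> pairwise linked I"
      using that incompat by (auto simp: pairwise_def subset_iff)
    finally show ?thesis .
  qed
  have T3_bound: "I \<subseteq> {1..12}" if "I \<in> T3_index_sets" for I
    using that triangles by blast

  have "{S. S \<subseteq> e ` {1..12} \<and> card S = 3 \<and> pairwise incompatible S} =
        (`) e ` {I. I \<subseteq> {1..12} \<and> card I = 3 \<and> pairwise linked I}"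
    (is "?family = _")
  proof (intro equalityI subsetI)
    fix S assume S: "S \<in> ?family"
    then obtain I where I: "I \<subseteq> {1..12}" "S = e ` I" by (auto simp: subset_image_iff)
    moreover have "card I = 3"
      using S I card_image[OF inj_on_subset[OF inj I(1)]] by simp
    ultimately show "S \<in> (`) e ` {I. I \<subseteq> {1..12} \<and> card I = 3 \<and> pairwise linked I}"
      using S pairwise by blast
  next
    fix S assume "S \<in> (`) e ` {I. I \<subseteq> {1..12} \<and> card I = 3 \<and> pairwise linked I}"
    then obtain I where I: "I \<subseteq> {1..12}" "card I = 3" "pairwise linked I" "S = e ` I" by blast
    then show "S \<in> ?family"
      using pairwise card_image[OF inj_on_subset[OF inj I(1)]] by auto
  qed
  then have family: "?family = (`) e ` T3_index_sets"
    by (simp only: triangles)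
  also have "\<dots> = {{e i, e j, e k} | i j k. {i, j, k} \<in> T3_index_sets}" (is "_ = ?triples")
  proof (intro equalityI subsetI)
    fix S assume "S \<in> (`) e ` T3_index_sets"
    then obtain I where I: "I \<in> T3_index_sets" "S = e ` I" by blast
    then obtain i j k where "I = {i, j, k}" using T3_index_sets_cyclic by blast
    with I show "S \<in> ?triples" by auto
  next
    fix S assume "S \<in> ?triples"
    then obtain i j k where "{i, j, k} \<in> T3_index_sets" "S = e ` {i, j, k}" by auto
    then show "S \<in> (`) e ` T3_index_sets" by blast
  qed
  finally have "?family = ?triples" .
  moreover have "card ?family = 8"
  proof -
    have "inj_on ((`) e) T3_index_sets"
      using T3_bound by (intro inj_onI) (meson inj inj_on_image_eq_iff)
    then show ?thesis unfolding family by (simp only: card_image card_T3_index_sets)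
  qed
  moreover have "forms_T3 (e i) (e j) (e k)" if T3: "{i, j, k} \<in> T3_index_sets" for i j k
  proof -
    have range: "i \<in> {1..12}" "j \<in> {1..12}" "k \<in> {1..12}" using T3_bound[OF T3] by auto
    from T3_index_triple_cyclic[OF T3] have
      "\<exists>d. d \<noteq> 0 \<and> det (e i - e j) = d \<and> det (e j - e k) = d \<and> det (e k - e i) = d"
    proof
      assume "cyclic i j k"
      then show ?thesis
        using \<open>K \<noteq> 0\<close> by (intro exI[of _ K]) (simp add: cyclic_def arc)
    next
      assume "cyclic k j i"
      then show ?thesis
        using \<open>K \<noteq> 0\<close> by (intro exI[of _ "- K"]) (simp add: cyclic_def reverse_arc)
    qed
    then show ?thesis
      using forms_T3_if_cyclic_det[OF sym[OF range(1)] sym[OF range(2)] sym[OF range(3)]]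
        tr[OF range(1)] tr[OF range(2)] tr[OF range(3)] by metis
  qed
  ultimately show ?thesis by blast
qed

end
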